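(* Let $k$ and $d$ be positive integers with $d \leq k$. If $D=(V,A)$ is a digraph with $\gamma(D) \leq k + \frac{d-k}{d+1}$ and $\Delta^{-}(D) \leq k+1$, then $D$ decomposes into $k+1$ branchings $B_{1}, \ldots, B_{k}, B_{k+1}$ with $\Delta^{+}(B_{k+1}) \leq d$.
   Context: Digraphs are finite, may have multiple arcs, and have no loops. For a digraph $D$, $V(D)$ is its vertex set and $A(D)$ its arc set. For $v \in V(D)$, $d_D^-(v)$ is the number of arcs of $D$ with head $v$ and $d_D^+(v)$ is the number of arcs of $D$ with tail $v$; $\Delta^-(D) = \max_{v \in V(D)} d_D^-(v)$ and $\Delta^+(D) = \max_{v \in V(D)} d_D^+(v)$. The fractional arboricity of $D$ is $\gamma(D) = \max_{H \subseteq D, |V(H)|>1} \frac{|A(H)|}{|V(H)|-1}$, the maximum being over subdigraphs $H$ of $D$ with more than one vertex (arcs counted with multiplicity). A subdigraph of $D$ is spanning if its vertex set is $V(D)$. A subdigraph $F$ of $D$ is an arborescence with root $r \in V(F)$ if its underlying graph is a tree and for every $u \in V(F)$ there is exactly one directed path in $F$ from $r$ to $u$ (a single vertex is an arborescence). A branching in $D$ is a spanning subdigraph each (weakly connected) component of which is an arborescence; it may have no arcs. A decomposition of $D$ into subdigraphs is a family of pairwise arc-disjoint subdigraphs whose union is $D$. *)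

theory Defs
  imports Complex_Main "Graph_Theory.Graph_Theory"
begin

text \<open>
  The maximum degrees and the fractional arboricity are maxima over possibly empty sets
  (digraphs without vertices, respectively with at most one vertex); there they are set to 0.
\<close>

definition max_in_degree :: "('a, 'b) pre_digraph \<Rightarrow> nat" where
  "max_in_degree D = (if verts D = {} then 0 else Max (in_degree D ` verts D))"

definition max_out_degree :: "('a, 'b) pre_digraph \<Rightarrow> nat" where
  "max_out_degree D = (if verts D = {} then 0 else Max (out_degree D ` verts D))"

definition fractional_arboricity :: "('a, 'b) pre_digraph \<Rightarrow> real" where
  "fractional_arboricity D =
     (if card (verts D) \<le> 1 then 0
      else Max {real (card (arcs H)) / (real (card (verts H)) - 1) | H.
                  subgraph H D \<and> 1 < card (verts H)})"

text \<open>
  The library's \<^const>\<open>forest\<close> and \<^const>\<open>tree\<close> exclude only directed cycles, and a symmetric digraph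
  with at least one arc always has one, so they cannot express that the underlying undirected
  multigraph is a tree. Here a cycle of the underlying multigraph is a cycle in which every arc
  may be traversed in either direction (\<open>True\<close>: forwards), but no arc is used twice. Two parallel
  or opposite arcs thus form a cycle of length 2.
\<close>

definition bidirect :: "('a, 'b) pre_digraph \<Rightarrow> ('a, 'b \<times> bool) pre_digraph" where
  "bidirect D = \<lparr>verts = verts D, arcs = arcs D \<times> UNIV,
     tail = (\<lambda>(e, fwd). if fwd then tail D e else head D e),
     head = (\<lambda>(e, fwd). if fwd then head D e else tail D e)\<rparr>"

definition underlying_cycle :: "('a, 'b) pre_digraph \<Rightarrow> ('b \<times> bool) list \<Rightarrow> bool" where
  "underlying_cycle D p \<longleftrightarrow> pre_digraph.cycle (bidirect D) p \<and> distinct (map fst p)"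

text \<open>\<^const>\<open>connected\<close> means weakly connected and nonempty.\<close>

definition underlying_tree :: "('a, 'b) pre_digraph \<Rightarrow> bool" where
  "underlying_tree D \<longleftrightarrow> connected D \<and> \<not> (\<exists>p. underlying_cycle D p)"

definition arborescence :: "('a, 'b) pre_digraph \<Rightarrow> 'a \<Rightarrow> bool" where
  "arborescence F r \<longleftrightarrow> r \<in> verts F \<and> underlying_tree F \<and>
     (\<forall>u \<in> verts F. \<exists>!p. pre_digraph.apath F r p u)"

definition branching :: "('a, 'b) pre_digraph \<Rightarrow> ('a, 'b) pre_digraph \<Rightarrow> bool" where
  "branching B D \<longleftrightarrow> spanning B D \<and>
     (\<forall>C. pre_digraph.max_subgraph B connected C \<longrightarrow> (\<exists>r. arborescence C r))"

definition decomposition ::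
  "('a, 'b) pre_digraph \<Rightarrow> 'i set \<Rightarrow> ('i \<Rightarrow> ('a, 'b) pre_digraph) \<Rightarrow> bool" where
  "decomposition D I B \<longleftrightarrow> (\<forall>i \<in> I. subgraph (B i) D) \<and>
     (\<forall>i \<in> I. \<forall>j \<in> I. i \<noteq> j \<longrightarrow> arcs (B i) \<inter> arcs (B j) = {}) \<and>
     pre_digraph.Union D (B ` I) = D"

end

theory Submission
  imports Defs
begin

text \<open>
  The bound on the fractional arboricity equals \<open>d (k + 1) / (d + 1)\<close>. Let \<open>U\<close> be the set of
  vertices of in-degree \<open>k + 1\<close>. For \<open>X \<subseteq> U\<close> with in-neighbourhood \<open>N(X)\<close>, all \<open>(k + 1) |X|\<close> arcs
  entering vertices of \<open>X\<close> lie inside \<open>X \<union> N(X)\<close>, and therefore \<open>|X| \<le> d |N(X) - X|\<close>. This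
  strengthening of Hall's condition, which counts only the neighbours outside \<open>X\<close>, allows choosing
  one incoming arc for each vertex of \<open>U\<close> acyclically and with all out-degrees at most \<open>d\<close>; these
  arcs form \<open>B\<^sub>k\<^sub>+\<^sub>1\<close>. The remaining digraph has in-degrees at most \<open>k\<close> and, since \<open>d \<le> k\<close>,
  fractional arboricity at most \<open>k\<close>, so it decomposes into \<open>k\<close> branchings by Frank's theorem.
  The latter follows from Edmonds' theorem on disjoint arborescences (with Lovasz's proof) after
  adding a root that is joined to each vertex \<open>v\<close> by \<open>k - d\<^sup>-(v)\<close> arcs. Acyclicity is witnessed
  throughout by a rank function that increases along the arcs.
\<close>

section \<open>Acyclic assignments under capacities\<close>

text \<open>
  As in the Halmos--Vaughan proof of Hall's theorem: either some \<open>v\<close> can be assigned to some \<open>t\<close>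
  outside \<open>U\<close>, or this is blocked by a tight set \<open>X\<close>. In the latter case, \<open>X\<close> uses up the capacity of
  its outer neighbours, so \<open>U - X\<close> can be assigned without entering \<open>X\<close>, and no cycle meets both.
\<close>

lemma acyclic_assignment:
  fixes N :: "'a \<Rightarrow> 'a set" and c :: "'a \<Rightarrow> nat"
  assumes "finite U" and "\<And>v. v \<in> U \<Longrightarrow> finite (N v)"
    and "\<And>X. X \<subseteq> U \<Longrightarrow> card X \<le> sum c (\<Union> (N ` X) - X)"
  shows "\<exists>p (r :: 'a \<Rightarrow> nat). (\<forall>v\<in>U. p v \<in> N v \<and> r (p v) < r v) \<and>
           (\<forall>t. card {v \<in> U. p v = t} \<le> c t)"
  using assms
proof (induction "card U" arbitrary: U c rule: less_induct)
  case less
  note finU = less.prems(1) and finN = less.prems(2) and hall = less.prems(3)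
  show ?case
  proof (cases "U = {}")
    case False
    then have "0 < sum c (\<Union> (N ` U) - U)"
      using hall[of U] finU by (metis card_gt_0_iff le_zero_eq not_gr_zero subset_refl)
    then obtain t where t: "t \<in> \<Union> (N ` U)" "t \<notin> U" "0 < c t"
      by (metis DiffE gr_zeroI less_irrefl sum.neutral)
    then obtain v where v: "v \<in> U" "t \<in> N v"
      by blast
    define c' where "c' = c(t := c t - 1)"
    show ?thesis
    proof (cases "\<forall>X. X \<subseteq> U - {v} \<longrightarrow> card X \<le> sum c' (\<Union> (N ` X) - X)")
      case True
      have "card (U - {v}) < card U"
        using v finU by (intro psubset_card_mono) auto
      have "\<exists>p (r :: 'a \<Rightarrow> nat). (\<forall>w\<in>U - {v}. p w \<in> N w \<and> r (p w) < r w) \<and>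
          (\<forall>x. card {w \<in> U - {v}. p w = x} \<le> c' x)"
        by (rule less.hyps[OF \<open>card (U - {v}) < card U\<close>]) (use True finU finN in auto)
      then obtain p and r :: "'a \<Rightarrow> nat" where
        p: "\<forall>w\<in>U - {v}. p w \<in> N w \<and> r (p w) < r w"
          "\<forall>x. card {w \<in> U - {v}. p w = x} \<le> c' x"
        by blast
      define p' where "p' = p(v := t)"
      \<comment> \<open>Since \<open>t\<close> lies outside \<open>U\<close>, nothing has to be
        ranked below it and it can take rank 0; the shift keeps all other ranks above it.\<close>
      define r' where "r' = (\<lambda>x. if x = t then 0 else Suc (r x))"
      have "p' w \<in> N w \<and> r' (p' w) < r' w" if "w \<in> U" for w
        using that p(1) v t by (auto simp: p'_def r'_def)
      moreover have "card {w \<in> U. p' w = x} \<le> c x" for x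
      proof (cases "x = t")
        case True
        then have "{w \<in> U. p' w = x} = insert v {w \<in> U - {v}. p w = x}"
          using v by (auto simp: p'_def)
        then show ?thesis
          using p(2)[rule_format, of t] finU t True by (simp add: c'_def)
      next
        case False
        then have "{w \<in> U. p' w = x} = {w \<in> U - {v}. p w = x}"
          by (auto simp: p'_def)
        then show ?thesis
          using p(2)[rule_format, of x] False by (simp add: c'_def)
      qed
      ultimately show ?thesis by blast
    next
      case False
      then obtain X where X: "X \<subseteq> U - {v}" "sum c' (\<Union> (N ` X) - X) < card X"
        by (meson not_le)
      define Y where "Y = \<Union> (N ` X)"
      have XU: "X \<subseteq> U" and finX: "finite X" and finY: "finite Y"
        using X finU finN by (auto simp: Y_def intro: finite_subset)
      have "sum c (Y - X) \<le> Suc (sum c' (Y - X))"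
      proof (cases "t \<in> Y - X")
        case True
        then show ?thesis
          using finY by (simp add: c'_def sum.remove[of "Y - X" t])
      next
        case False
        then have "sum c (Y - X) = sum c' (Y - X)"
          by (intro sum.cong) (auto simp: c'_def)
        then show ?thesis by simp
      qed
      then have tight: "sum c (Y - X) = card X"
        using X(2) hall[OF XU] by (simp add: Y_def)
      have "card X < card U" using v X finU by (intro psubset_card_mono) auto
      have "\<exists>p (r :: 'a \<Rightarrow> nat). (\<forall>w\<in>X. p w \<in> N w \<and> r (p w) < r w) \<and>
          (\<forall>x. card {w \<in> X. p w = x} \<le> c x)"
      proof (rule less.hyps[OF \<open>card X < card U\<close> finX])
        show "finite (N w)" if "w \<in> X" for w
          using that XU finN by blast
        show "card Z \<le> sum c (\<Union> (N ` Z) - Z)" if "Z \<subseteq> X" for Z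
          using that XU by (intro hall) auto
      qed
      then obtain p1 and r1 :: "'a \<Rightarrow> nat" where
        p1: "\<forall>w\<in>X. p1 w \<in> N w \<and> r1 (p1 w) < r1 w" "\<forall>x. card {w \<in> X. p1 w = x} \<le> c x"
        by blast
      \<comment> \<open>Capacity zero on \<open>X \<union> Y\<close> keeps \<open>p2\<close> out of
        this set. Hall's condition survives: subtract the equality for \<open>X\<close> from the
        inequality for \<open>X \<union> Z\<close>.\<close>
      define c2 where "c2 = (\<lambda>x. if x \<in> X \<union> Y then 0 else c x)"
      have hall2: "card Z \<le> sum c2 (\<Union> (N ` Z) - Z)" if Z: "Z \<subseteq> U - X" for Z
      proof -
        have finNZ: "finite (\<Union> (N ` Z))"
          using Z finU finN by (auto intro: finite_subset)
        have "card X + card Z = card (X \<union> Z)"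
          using Z finX finU by (subst card_Un_disjoint) (auto intro: finite_subset)
        also have "\<dots> \<le> sum c (\<Union> (N ` (X \<union> Z)) - (X \<union> Z))"
          using Z XU by (intro hall) auto
        also have "\<dots> \<le> sum c ((Y - X) \<union> (\<Union> (N ` Z) - Z - (X \<union> Y)))"
          using finY finNZ by (intro sum_mono2) (auto simp: Y_def)
        also have "\<dots> = sum c (Y - X) + sum c (\<Union> (N ` Z) - Z - (X \<union> Y))"
          using finY finNZ by (intro sum.union_disjoint) auto
        also have "sum c (\<Union> (N ` Z) - Z - (X \<union> Y)) = sum c2 (\<Union> (N ` Z) - Z)"
          using finNZ by (intro sum.mono_neutral_cong_left) (auto simp: c2_def)
        finally show ?thesis using tight by simp
      qed
      have "X \<noteq> {}" using X(2) by auto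
      then have "card (U - X) < card U" using XU finU by (intro psubset_card_mono) auto
      have "\<exists>p (r :: 'a \<Rightarrow> nat). (\<forall>w\<in>U - X. p w \<in> N w \<and> r (p w) < r w) \<and>
          (\<forall>x. card {w \<in> U - X. p w = x} \<le> c2 x)"
        by (rule less.hyps[OF \<open>card (U - X) < card U\<close>]) (use finU finN hall2 in auto)
      then obtain p2 and r2 :: "'a \<Rightarrow> nat" where
        p2: "\<forall>w\<in>U - X. p2 w \<in> N w \<and> r2 (p2 w) < r2 w"
          "\<forall>x. card {w \<in> U - X. p2 w = x} \<le> c2 x"
        by blast
      have p2_out: "p2 w \<notin> X \<union> Y" if "w \<in> U - X" for w
      proof -
        have "card {w' \<in> U - X. p2 w' = p2 w} > 0"
          using that finU by (auto simp: card_gt_0_iff)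
        then show ?thesis
          using p2(2)[rule_format, of "p2 w"] by (auto simp: c2_def split: if_splits)
      qed
      have p1_in: "p1 w \<in> Y" if "w \<in> X" for w
        using that p1 by (auto simp: Y_def)
      define p where "p = (\<lambda>w. if w \<in> X then p1 w else p2 w)"
      \<comment> \<open>No \<open>p2 w\<close> lies in \<open>X\<close>, so the ranks on
        \<open>X\<close> may be lifted as a whole. Adding \<open>m\<close> lifts them over those
        \<open>p1 w\<close> that lie outside \<open>X\<close> and keep rank
        \<open>r2\<close>.\<close>
      define m where "m = (\<Sum>w\<in>X. r2 (p1 w))"
      define r where "r = (\<lambda>x. if x \<in> X then Suc (r1 x + m) else r2 x)"
      have m: "r2 (p1 w) \<le> m" if "w \<in> X" for w
        unfolding m_def using that finX by (intro member_le_sum) auto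
      have "p w \<in> N w \<and> r (p w) < r w" if "w \<in> U" for w
      proof (cases "w \<in> X")
        case True
        then show ?thesis
          using p1(1) m[OF True] by (auto simp: p_def r_def)
      next
        case False
        then show ?thesis
          using that p2(1) p2_out[of w] by (auto simp: p_def r_def)
      qed
      moreover have "card {w \<in> U. p w = x} \<le> c x" for x
      proof (cases "x \<in> X \<union> Y")
        case True
        then have "p2 w \<noteq> x" if "w \<in> U - X" for w
          using p2_out[OF that] by blast
        then have "{w \<in> U. p w = x} = {w \<in> X. p1 w = x}"
          using XU by (auto simp: p_def)
        then show ?thesis using p1(2) by simp
      next
        case False
        then have "{w \<in> U. p w = x} = {w \<in> U - X. p2 w = x}"
          using p1_in by (auto simp: p_def)
        then show ?thesis
          using p2(2)[rule_format, of x] False by (simp add: c2_def)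
      qed
      ultimately show ?thesis by blast
    qed
  qed auto
qed

section \<open>Disjoint spanning arborescences\<close>

text \<open>Tail map, head map and arc set are separate parameters, so that arcs can be deleted and
  the digraph with an added root can use another arc type.\<close>

definition entering :: "('e \<Rightarrow> 'v) \<Rightarrow> ('e \<Rightarrow> 'v) \<Rightarrow> 'e set \<Rightarrow> 'v set \<Rightarrow> 'e set" where
  "entering t h E X = {e \<in> E. h e \<in> X \<and> t e \<notin> X}"

lemma finite_entering: "finite E \<Longrightarrow> finite (entering t h E X)"
  by (simp add: entering_def)

text \<open>An arc entering \<open>A \<inter> B\<close> or \<open>A \<union> B\<close> enters
  \<open>A\<close> or \<open>B\<close>, and an arc entering both of the former enters both of the
  latter.\<close>

lemma card_entering_submodular:
  assumes "finite E"
  shows "card (entering t h E (A \<inter> B)) + card (entering t h E (A \<union> B))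
           \<le> card (entering t h E A) + card (entering t h E B)"
proof -
  let ?d = "entering t h E"
  have fin: "finite (?d X)" for X
    using assms by (rule finite_entering)
  have "card (?d (A \<inter> B)) + card (?d (A \<union> B))
      = card (?d (A \<inter> B) \<union> ?d (A \<union> B)) + card (?d (A \<inter> B) \<inter> ?d (A \<union> B))"
    by (intro card_Un_Int fin)
  also have "\<dots> \<le> card (?d A \<union> ?d B) + card (?d A \<inter> ?d B)"
    by (intro add_mono card_mono finite_UnI finite_Int disjI1 fin) (auto simp: entering_def)
  also have "\<dots> = card (?d A) + card (?d B)"
    by (intro card_Un_Int[symmetric] fin)
  finally show ?thesis .
qed

text \<open>
  The root \<open>s\<close> is implicit: if all tails lie in \<open>insert s V\<close> with \<open>s \<notin> V\<close>, then following the arcs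
  backwards from any vertex decreases the rank and can only stop at \<open>s\<close>.
\<close>

definition spanning_arborescence ::
  "('e \<Rightarrow> 'v) \<Rightarrow> ('e \<Rightarrow> 'v) \<Rightarrow> 'v set \<Rightarrow> 'e set \<Rightarrow> bool" where
  "spanning_arborescence t h V F \<longleftrightarrow> (\<forall>v\<in>V. \<exists>!e. e \<in> F \<and> h e = v) \<and>
     (\<exists>r :: 'v \<Rightarrow> nat. \<forall>e\<in>F. r (t e) < r (h e))"

text \<open>
  Lovasz's argument: the arborescence is grown by an arc entering \<open>A - R\<close> from \<open>A \<inter> R\<close>, where \<open>R\<close> is
  the set reached so far and \<open>A\<close> is a minimal tight set not contained in \<open>R\<close>. A tight set \<open>B\<close>
  entered by this arc would, by submodularity, make the smaller set \<open>A \<inter> B\<close> tight.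
\<close>

lemma spanning_arborescence_extraction:
  assumes finE: "finite E" and finV: "finite V" and s: "s \<notin> V"
    and ends: "\<And>e. e \<in> E \<Longrightarrow> t e \<in> insert s V \<and> h e \<in> V"
    and cut: "\<And>X. X \<subseteq> V \<Longrightarrow> X \<noteq> {} \<Longrightarrow> Suc k \<le> card (entering t h E X)"
  shows "\<exists>F\<subseteq>E. spanning_arborescence t h V F \<and>
           (\<forall>X\<subseteq>V. X \<noteq> {} \<longrightarrow> k \<le> card (entering t h (E - F) X))"
proof -
  \<comment> \<open>\<open>R\<close> collects the reached vertices other than \<open>s\<close>. The
    last conjunct reserves \<open>k\<close> entering arcs for the arborescences still to be
    extracted.\<close>
  define inv where "inv R F \<longleftrightarrow> R \<subseteq> V \<and> F \<subseteq> E \<and> (\<forall>e\<in>F. t e \<in> insert s R \<and> h e \<in> R) \<and>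
    spanning_arborescence t h R F \<and>
    (\<forall>X\<subseteq>V. X \<noteq> {} \<longrightarrow> k \<le> card (entering t h (E - F) X))" for R F
  have step: "\<exists>y e. y \<in> V - R \<and> inv (insert y R) (insert e F)" if I: "inv R F" and "R \<noteq> V" for R F
  proof -
    have R: "R \<subseteq> V" "F \<subseteq> E" "\<forall>e\<in>F. t e \<in> insert s R \<and> h e \<in> R" "spanning_arborescence t h R F"
      and cutF: "\<And>X. X \<subseteq> V \<Longrightarrow> X \<noteq> {} \<Longrightarrow> k \<le> card (entering t h (E - F) X)"
      using I by (auto simp: inv_def)
    let ?d = "entering t h (E - F)"
    have fin: "finite (?d X)" for X
      using finE by (simp add: finite_entering)
    \<comment> \<open>Arcs of \<open>F\<close> have their heads in \<open>R\<close>, so deleting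
      \<open>F\<close> does not weaken the cuts of sets disjoint from \<open>R\<close>; the nonempty
      ones keep \<open>Suc k\<close> arcs.\<close>
    have out: "?d (X - R) = entering t h E (X - R)" for X
      using R(3) by (auto simp: entering_def)
    \<comment> \<open>By \<open>cutF\<close>, such a set is entered by exactly \<open>k\<close> arcs
      and can spare none. Sets inside \<open>R\<close> are left out, as an arc with head outside
      \<open>R\<close> cannot enter them.\<close>
    define tight where "tight X \<longleftrightarrow> X \<subseteq> V \<and> X - R \<noteq> {} \<and> card (?d X) \<le> k" for X
    obtain e where e: "e \<in> E - F" "h e \<in> V - R" "t e \<in> insert s R"
      and safe: "\<And>X. tight X \<Longrightarrow> e \<notin> ?d X"
    proof (cases "\<exists>X. tight X")
      case False
      have "Suc k \<le> card (?d (V - R))"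
        unfolding out using R(1) \<open>R \<noteq> V\<close> by (intro cut) auto
      then have "?d (V - R) \<noteq> {}"
        by auto
      then obtain e where "e \<in> ?d (V - R)"
        by blast
      then show thesis
        using that[of e] False ends[of e] by (auto simp: entering_def)
    next
      case True
      define A where "A = arg_min card tight"
      have A: "tight A" and A_min: "\<And>X. tight X \<Longrightarrow> card A \<le> card X"
        using True arg_min_nat_lemma[of tight _ card] unfolding A_def by blast+
      have AV: "A \<subseteq> V" and finA: "finite A" and "A - R \<noteq> {}" and dA: "card (?d A) \<le> k"
        using A finV by (auto simp: tight_def intro: finite_subset)
      then have "Suc k \<le> card (?d (A - R))"
        unfolding out by (intro cut) auto
      then have "\<not> ?d (A - R) \<subseteq> ?d A"
        using dA card_mono[OF fin[of A]] by (meson Suc_n_not_le_n order_trans)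
      then obtain e where e: "e \<in> ?d (A - R)" "e \<notin> ?d A"
        by blast
      then have e': "e \<in> E - F" "h e \<in> A - R" "t e \<in> A" "t e \<in> R"
        by (auto simp: entering_def)
      have "e \<notin> ?d B" if B: "tight B" for B
      proof
        assume "e \<in> ?d B"
        then have eB: "h e \<in> B" "t e \<notin> B"
          by (auto simp: entering_def)
        have "card (?d (A \<inter> B)) + card (?d (A \<union> B)) \<le> card (?d A) + card (?d B)"
          using finE by (intro card_entering_submodular) auto
        moreover have "k \<le> card (?d (A \<union> B))"
          using AV B e' by (intro cutF) (auto simp: tight_def)
        ultimately have "tight (A \<inter> B)"
          using dA B AV e' eB by (auto simp: tight_def)
        then have "card A \<le> card (A \<inter> B)"
          by (rule A_min)
        moreover have "card (A \<inter> B) < card A"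
          using finA e' eB by (intro psubset_card_mono) auto
        ultimately show False by simp
      qed
      with e' AV show thesis
        using that[of e] by auto
    qed
    obtain r :: "'b \<Rightarrow> nat" where r: "\<forall>e\<in>F. r (t e) < r (h e)"
      using R(4) by (auto simp: spanning_arborescence_def)
    \<comment> \<open>The new vertex \<open>h e\<close> is no end of an arc of \<open>F\<close>, so
      its rank can be set freely.\<close>
    define r' where "r' = r(h e := Suc (r (t e)))"
    have "t e \<noteq> h e"
      using e s by auto
    have "h e \<notin> insert s R"
      using e s by auto
    then have "\<forall>a\<in>insert e F. r' (t a) < r' (h a)"
      using r R(3) \<open>t e \<noteq> h e\<close> by (auto simp: r'_def)
    moreover have "\<exists>!a. a \<in> insert e F \<and> h a = v" if "v \<in> insert (h e) R" for v
    proof (cases "v = h e")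
      case True
      then show ?thesis using e R(3) by auto
    next
      case False
      then have "\<exists>!a. a \<in> F \<and> h a = v"
        using that R(4) by (auto simp: spanning_arborescence_def)
      with False show ?thesis by auto
    qed
    ultimately have "spanning_arborescence t h (insert (h e) R) (insert e F)"
      unfolding spanning_arborescence_def by blast
    moreover have "k \<le> card (entering t h (E - insert e F) X)" if X: "X \<subseteq> V" "X \<noteq> {}" for X
    proof -
      have eq: "entering t h (E - insert e F) X = ?d X - {e}"
        by (auto simp: entering_def)
      show ?thesis
      proof (cases "e \<in> ?d X")
        case True
        then have "\<not> tight X" using safe by blast
        then have "k < card (?d X)"
          using X True e by (auto simp: tight_def entering_def)
        then show ?thesis
          unfolding eq using True by (simp add: fin)
      next
        case False
        then show ?thesis
          unfolding eq using cutF[OF X] by simp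
      qed
    qed
    ultimately have "inv (insert (h e) R) (insert e F)"
      using R e unfolding inv_def by auto
    then show ?thesis using e by blast
  qed
  have grow: "inv R F \<Longrightarrow> \<exists>F. inv V F" for R F
  proof (induction "card (V - R)" arbitrary: R F rule: less_induct)
    case less
    show ?case
    proof (cases "R = V")
      case False
      from step[OF less.prems this] obtain y e where
        y: "y \<in> V - R" "inv (insert y R) (insert e F)" by blast
      have "card (V - insert y R) < card (V - R)"
        using y finV by (intro psubset_card_mono) auto
      then show ?thesis using less.hyps y(2) by blast
    qed (use less.prems in blast)
  qed
  have "inv {} {}"
    unfolding inv_def spanning_arborescence_def using cut by (auto dest: Suc_leD)
  from grow[OF this] show ?thesis
    unfolding inv_def by blast
qed

text \<open>The arborescences are split off one at a time; each extraction lowers the number of arcs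
  guaranteed to enter a nonempty set by only one.\<close>

theorem edmonds_disjoint_arborescences:
  assumes "finite E" and "finite V" and "s \<notin> V"
    and "\<And>e. e \<in> E \<Longrightarrow> t e \<in> insert s V \<and> h e \<in> V"
    and "\<And>X. X \<subseteq> V \<Longrightarrow> X \<noteq> {} \<Longrightarrow> k \<le> card (entering t h E X)"
  shows "\<exists>F :: nat \<Rightarrow> 'e set. (\<forall>i<k. F i \<subseteq> E \<and> spanning_arborescence t h V (F i)) \<and>
           disjoint_family_on F {..<k}"
  using assms
proof (induction k arbitrary: E)
  case 0
  then show ?case by (auto simp: disjoint_family_on_def)
next
  case (Suc k)
  obtain F0 where F0: "F0 \<subseteq> E" "spanning_arborescence t h V F0"
    "\<forall>X\<subseteq>V. X \<noteq> {} \<longrightarrow> k \<le> card (entering t h (E - F0) X)"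
    using spanning_arborescence_extraction[OF Suc.prems] by auto
  then obtain F where F: "\<forall>i<k. F i \<subseteq> E - F0 \<and> spanning_arborescence t h V (F i)"
      "disjoint_family_on F {..<k}"
    using Suc.IH[of "E - F0"] Suc.prems by auto
  have "disjoint_family_on (F(k := F0)) {..<Suc k}"
    using F by (fastforce simp: disjoint_family_on_def less_Suc_eq)
  moreover have "\<forall>i<Suc k. (F(k := F0)) i \<subseteq> E \<and> spanning_arborescence t h V ((F(k := F0)) i)"
    using F F0 by (auto simp: less_Suc_eq)
  ultimately show ?case by blast
qed


section \<open>Decomposition into branchings\<close>

text \<open>With the root arcs added, every vertex has exactly \<open>k\<close> entering arcs. A
  nonempty \<open>X\<close> thus contains the heads of \<open>k * card X\<close> arcs, at most
  \<open>k * (card X - 1)\<close> of which start inside, and Edmonds' condition follows.\<close>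

lemma frank_branching_decomposition:
  fixes t h :: "'b \<Rightarrow> 'a"
  assumes finA: "finite A" and finV: "finite V"
    and ends: "\<And>a. a \<in> A \<Longrightarrow> t a \<in> V \<and> h a \<in> V"
    and indeg: "\<And>v. v \<in> V \<Longrightarrow> card {a \<in> A. h a = v} \<le> k"
    and sparse: "\<And>X. X \<subseteq> V \<Longrightarrow> X \<noteq> {} \<Longrightarrow> card {a \<in> A. t a \<in> X \<and> h a \<in> X} \<le> k * (card X - 1)"
  shows "\<exists>F :: nat \<Rightarrow> 'b set. (\<Union>i<k. F i) = A \<and> disjoint_family_on F {..<k} \<and>
           (\<forall>i<k. inj_on h (F i) \<and> (\<exists>r :: 'a \<Rightarrow> nat. \<forall>a\<in>F i. r (t a) < r (h a)))"
proof -
  \<comment> \<open>Pairs \<open>(v, j)\<close> number the parallel arcs from the new root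
    \<open>None\<close> to \<open>Some v\<close> that bring the in-degree of \<open>v\<close> up to
    \<open>k\<close>.\<close>
  define S where "S X = (SIGMA v:X. {..<k - card {a \<in> A. h a = v}})" for X
  define E where "E = Inl ` A \<union> Inr ` S V"
  define T where "T = (\<lambda>e :: 'b + 'a \<times> nat. case e of Inl a \<Rightarrow> Some (t a) | Inr _ \<Rightarrow> None)"
  define H where "H = (\<lambda>e :: 'b + 'a \<times> nat. case e of Inl a \<Rightarrow> Some (h a) | Inr (v, _) \<Rightarrow> Some v)"
  have finS: "finite (S X)" if "X \<subseteq> V" for X
    unfolding S_def using that finV by (auto intro: finite_subset)
  have finE: "finite E"
    unfolding E_def using finA finS by auto
  have cardS: "card (S X) + card {a \<in> A. h a \<in> X} = k * card X" if "X \<subseteq> V" for X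
  proof -
    have finX: "finite X" using that finV by (rule finite_subset)
    have "card (S X) = (\<Sum>v\<in>X. k - card {a \<in> A. h a = v})"
      unfolding S_def using finX by simp
    moreover have "card {a \<in> A. h a \<in> X} = (\<Sum>v\<in>X. card {a \<in> A. h a = v})"
    proof -
      have "{a \<in> A. h a \<in> X} = (\<Union>v\<in>X. {a \<in> A. h a = v})" by auto
      then show ?thesis
        using finX finA by (simp only:) (intro card_UN_disjoint; auto)
    qed
    ultimately have "card (S X) + card {a \<in> A. h a \<in> X}
        = (\<Sum>v\<in>X. (k - card {a \<in> A. h a = v}) + card {a \<in> A. h a = v})"
      by (simp add: sum.distrib)
    also have "\<dots> = (\<Sum>v\<in>X. k)"
      using that indeg by (intro sum.cong) auto
    finally show ?thesis by simp
  qed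
  have cut: "k \<le> card (entering T H E Y)" if Y: "Y \<subseteq> Some ` V" "Y \<noteq> {}" for Y
  proof -
    obtain X where X: "Y = Some ` X" "X \<subseteq> V" "X \<noteq> {}"
      using Y by (auto simp: subset_image_iff)
    have finX: "finite X" using X finV by (auto intro: finite_subset)
    have "entering T H E Y = Inl ` {a \<in> A. h a \<in> X \<and> t a \<notin> X} \<union> Inr ` S X"
      using X by (auto simp: entering_def E_def T_def H_def S_def)
    then have "card (entering T H E Y) = card {a \<in> A. h a \<in> X \<and> t a \<notin> X} + card (S X)"
      using finA finS[OF X(2)] by (simp only:) (subst card_Un_disjoint; auto simp: card_image)
    moreover have "card {a \<in> A. h a \<in> X}
        = card {a \<in> A. h a \<in> X \<and> t a \<notin> X} + card {a \<in> A. t a \<in> X \<and> h a \<in> X}"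
      using finA by (subst card_Un_disjoint[symmetric]) (auto intro: arg_cong[where f = card])
    moreover have "k * card X = k * (card X - 1) + k"
      using X finX by (metis Suc_diff_1 card_gt_0_iff mult_Suc_right add.commute)
    ultimately show ?thesis
      using cardS[OF X(2)] sparse[OF X(2,3)] by linarith
  qed
  have "None \<notin> Some ` V" by auto
  moreover have "T e \<in> insert None (Some ` V) \<and> H e \<in> Some ` V" if "e \<in> E" for e
    using that ends by (auto simp: E_def T_def H_def S_def)
  ultimately obtain F where F: "\<forall>i<k. F i \<subseteq> E \<and> spanning_arborescence T H (Some ` V) (F i)"
    and disj: "disjoint_family_on F {..<k}"
    using edmonds_disjoint_arborescences[OF finE finite_imageI[OF finV], of None Some T H k] cut
    by blast
  have uniq: "\<exists>!e. e \<in> F i \<and> H e = Some v" if "i < k" "v \<in> V" for i v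
    using that F by (auto simp: spanning_arborescence_def)
  \<comment> \<open>Each of the \<open>k\<close> disjoint arborescences uses one of the exactly
    \<open>k\<close> arcs entering \<open>Some v\<close>, so no arc is left over.\<close>
  have "Inl a \<in> (\<Union>i<k. F i)" if a: "a \<in> A" for a
  proof -
    define v where "v = h a"
    have v: "v \<in> V" using a ends by (simp add: v_def)
    have Ev: "{e \<in> E. H e = Some v} = Inl ` {b \<in> A. h b \<in> {v}} \<union> Inr ` S {v}"
      using v by (auto simp: E_def H_def S_def)
    have cardEv: "card {e \<in> E. H e = Some v} = k"
      unfolding Ev using finA finS[of "{v}"] cardS[of "{v}"] v
      by (subst card_Un_disjoint) (auto simp: card_image)
    have "card (\<Union>i<k. {e \<in> F i. H e = Some v}) = (\<Sum>i<k. card {e \<in> F i. H e = Some v})"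
      using disj finite_subset[OF _ finE] F
      by (intro card_UN_disjoint) (auto simp: disjoint_family_on_def)
    also have "\<dots> = (\<Sum>i<k. 1)"
    proof (intro sum.cong refl)
      fix i assume "i \<in> {..<k}"
      then obtain e where "{e \<in> F i. H e = Some v} = {e}"
        using uniq[of i v] v by blast
      then show "card {e \<in> F i. H e = Some v} = 1" by simp
    qed
    finally have "card (\<Union>i<k. {e \<in> F i. H e = Some v}) = k" by simp
    moreover have "(\<Union>i<k. {e \<in> F i. H e = Some v}) \<subseteq> {e \<in> E. H e = Some v}"
      using F by auto
    ultimately have "(\<Union>i<k. {e \<in> F i. H e = Some v}) = {e \<in> E. H e = Some v}"
      using cardEv finE by (intro card_subset_eq) auto
    moreover have "Inl a \<in> {e \<in> E. H e = Some v}"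
      using a by (auto simp: E_def H_def v_def)
    ultimately show ?thesis by blast
  qed
  then have "(\<Union>i<k. Inl -` F i) = A"
    using F by (fastforce simp: E_def)
  moreover have "disjoint_family_on (\<lambda>i. Inl -` F i) {..<k}"
    using disj by (auto simp: disjoint_family_on_def)
  moreover have "inj_on h (Inl -` F i)" if i: "i < k" for i
  proof (rule inj_onI)
    fix a b assume ab: "a \<in> Inl -` F i" "b \<in> Inl -` F i" "h a = h b"
    then have "a \<in> A" using F i by (auto simp: E_def)
    then have "h a \<in> V" using ends by blast
    moreover have "H (Inl a) = Some (h a)" "H (Inl b) = Some (h a)"
      using ab by (simp_all add: H_def)
    ultimately have "(Inl a :: 'b + 'a \<times> nat) = Inl b"
      using uniq[OF i, of "h a"] ab by blast
    then show "a = b" by simp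
  qed
  moreover have "\<exists>r :: 'a \<Rightarrow> nat. \<forall>a\<in>Inl -` F i. r (t a) < r (h a)" if i: "i < k" for i
  proof -
    obtain r :: "'a option \<Rightarrow> nat" where r: "\<forall>e\<in>F i. r (T e) < r (H e)"
      using F i by (auto simp: spanning_arborescence_def)
    have "(r \<circ> Some) (t a) < (r \<circ> Some) (h a)" if "a \<in> Inl -` F i" for a
      using r[rule_format, of "Inl a"] that by (simp add: T_def H_def)
    then show ?thesis by blast
  qed
  ultimately show ?thesis
    by (intro exI[of _ "\<lambda>i. Inl -` F i"]) simp
qed

section \<open>Branchings from injective heads and an increasing rank\<close>

lemma (in pre_digraph) cas_nth:
  assumes "cas u p v" and "i < length p"
  shows "tail G (p ! i) = (if i = 0 then u else head G (p ! (i - 1)))"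
  using assms by (induction u p v arbitrary: i rule: cas.induct) (auto simp: nth_Cons split: nat.splits)

lemma (in pre_digraph) cas_last:
  assumes "cas u p v" and "p \<noteq> []"
  shows "head G (last p) = v"
  using assms by (induction u p v rule: cas.induct) auto

text \<open>
  At a vertex of maximal rank on an underlying cycle, both cycle arcs would be incoming.
\<close>

lemma (in pre_digraph) no_underlying_cycle:
  fixes r :: "'a \<Rightarrow> nat"
  assumes inj: "inj_on (head G) (arcs G)"
    and rank: "\<And>e. e \<in> arcs G \<Longrightarrow> r (tail G e) < r (head G e)"
  shows "\<not> underlying_cycle G p"
proof
  assume "underlying_cycle G p"
  then obtain u where walk: "pre_digraph.awalk (bidirect G) u p u" and "p \<noteq> []"
    and dist: "distinct (map fst p)"
    by (auto simp: underlying_cycle_def pre_digraph.cycle_def)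
  define n where "n = length p"
  have n: "n > 0" using \<open>p \<noteq> []\<close> by (simp add: n_def)
  define hd' where "hd' i = head (bidirect G) (p ! i)" for i
  define tl' where "tl' i = tail (bidirect G) (p ! i)" for i
  have cas: "pre_digraph.cas (bidirect G) u p u" and "set p \<subseteq> arcs (bidirect G)"
    using walk by (auto simp: pre_digraph.awalk_def)
  then have arcs: "fst (p ! i) \<in> arcs G" if "i < n" for i
    using that nth_mem[of i p] by (fastforce simp: n_def bidirect_def)
  have ends: "hd' i = head G (fst (p ! i)) \<and> tl' i = tail G (fst (p ! i)) \<or>
      hd' i = tail G (fst (p ! i)) \<and> tl' i = head G (fst (p ! i))" for i
    by (auto simp: hd'_def tl'_def bidirect_def split: prod.split)
  have last: "hd' (n - 1) = u"
    using pre_digraph.cas_last[OF cas \<open>p \<noteq> []\<close>] \<open>p \<noteq> []\<close>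
    by (simp add: hd'_def n_def last_conv_nth)
  have tl': "tl' i = (if i = 0 then u else hd' (i - 1))" if "i < n" for i
    using pre_digraph.cas_nth[OF cas] that by (simp add: tl'_def hd'_def n_def)
  define m where "m = Max ((\<lambda>i. r (hd' i)) ` {..<n})"
  have le_m: "r (hd' i) \<le> m" if "i < n" for i
    unfolding m_def using that by (intro Max_ge) auto
  have "m \<in> (\<lambda>i. r (hd' i)) ` {..<n}"
    unfolding m_def using n by (intro Max_in) auto
  then obtain i where i: "i < n" "r (hd' i) = m"
    by auto
  \<comment> \<open>\<open>j\<close> is the cyclic successor of \<open>i\<close>, where the walk
    leaves a vertex of maximal rank; the wraparound uses that the walk is closed.\<close>
  define j where "j = (if Suc i = n then 0 else Suc i)"
  have j: "j < n" "tl' j = hd' i"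
    using i n tl'[of j] last by (auto simp: j_def)
  have "r (tl' i) \<le> m"
    using i tl'[of i] le_m[of "i - 1"] le_m[of "n - 1"] last n by (auto split: if_splits)
  then have "hd' i = head G (fst (p ! i))"
    using ends[of i] rank[OF arcs[OF i(1)]] i by auto
  moreover have "tl' j = head G (fst (p ! j))"
    using ends[of j] rank[OF arcs[OF j(1)]] i j le_m[OF j(1)] by auto
  ultimately have "fst (p ! i) = fst (p ! j)"
    using inj arcs i j by (metis inj_onD)
  then have "i = j"
    using dist i j by (auto simp: n_def distinct_conv_nth)
  then show False
    using ends[of i] rank[OF arcs[OF i(1)]] j by auto
qed

text \<open>Induction from the end of the walk: the last arc is determined by its head, and no arc
  leads back to \<open>s\<close>.\<close>

lemma (in wf_digraph) awalk_unique:
  fixes r :: "'a \<Rightarrow> nat"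
  assumes inj: "inj_on (head G) (arcs G)"
    and root: "\<And>e. e \<in> arcs G \<Longrightarrow> head G e \<noteq> s"
    and "awalk s p v" and "awalk s q v"
  shows "p = q"
  using assms(3,4)
proof (induction p arbitrary: v q rule: rev_induct)
  case Nil
  show ?case
  proof (cases q rule: rev_cases)
    case (snoc q' e)
    then show ?thesis
      using Nil root[of e] by (auto simp: awalk_simps)
  qed simp
next
  case (snoc e p)
  have e: "e \<in> arcs G" "head G e = v" "awalk s p (tail G e)"
    using snoc.prems(1) by (auto simp: awalk_simps)
  show ?case
  proof (cases q rule: rev_cases)
    case Nil
    then show ?thesis
      using snoc.prems root e by (auto simp: awalk_simps)
  next
    case (snoc q' f)
    then have f: "f \<in> arcs G" "head G f = v" "awalk s q' (tail G f)"
      using snoc.prems(2) by (auto simp: awalk_simps)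
    then have "f = e"
      using inj e by (auto dest: inj_onD)
    then show ?thesis
      using snoc.IH[OF e(3)] f snoc by simp
  qed
qed

text \<open>A vertex of minimal rank is entered by no arc and serves as the root. Weak connectivity
  becomes reachability from it because each vertex is entered by at most one arc.\<close>

lemma (in wf_digraph) connected_imp_arborescence:
  fixes r :: "'a \<Rightarrow> nat"
  assumes conn: "connected G" and inj: "inj_on (head G) (arcs G)"
    and rank: "\<And>e. e \<in> arcs G \<Longrightarrow> r (tail G e) < r (head G e)"
  shows "\<exists>s. arborescence G s"
proof -
  have ne: "verts G \<noteq> {}"
    and weak: "\<And>u v. u \<in> verts G \<Longrightarrow> v \<in> verts G \<Longrightarrow> (u, v) \<in> rtrancl_on (verts G) ((arcs_ends G)\<^sup>s)"
    using conn by (auto simp: connected_conv)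
  define s where "s = arg_min r (\<lambda>v. v \<in> verts G)"
  have s: "s \<in> verts G" and s_min: "\<And>v. v \<in> verts G \<Longrightarrow> r s \<le> r v"
    using ne arg_min_nat_lemma[of "\<lambda>v. v \<in> verts G" _ r] unfolding s_def by blast+
  have root: "head G e \<noteq> s" if "e \<in> arcs G" for e
    using rank[OF that] s_min[of "tail G e"] that by auto
  have adj: "s \<rightarrow>\<^sup>* w" if vw: "s \<rightarrow>\<^sup>* v" "(v, w) \<in> (arcs_ends G)\<^sup>s" for v w
  proof (cases "(v, w) \<in> arcs_ends G")
    case True
    then show ?thesis using vw(1) by (simp add: reachable_adj_trans)
  next
    \<comment> \<open>Here \<open>e\<close> is traversed backwards. The walk from \<open>s\<close>
      to \<open>v\<close> is not empty and must end with \<open>e\<close>, so its initial part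
      reaches \<open>w\<close>.\<close>
    case False
    then obtain e where e: "e \<in> arcs G" "tail G e = w" "head G e = v"
      using vw(2) by (auto simp: symcl_def arcs_ends_conv)
    obtain p where p: "awalk s p v"
      using vw(1) by (auto simp: reachable_awalk)
    show ?thesis
    proof (cases p rule: rev_cases)
      case Nil
      then show ?thesis using p root e by (auto simp: awalk_simps)
    next
      case (snoc p' f)
      then have "f \<in> arcs G" "head G f = v" "awalk s p' (tail G f)"
        using p by (auto simp: awalk_simps)
      moreover from this have "f = e"
        using inj e by (auto dest: inj_onD)
      ultimately show ?thesis
        using e by (auto simp: reachable_awalk)
    qed
  qed
  have "s \<rightarrow>\<^sup>* v" if "v \<in> verts G" for v
    using weak[OF s that]
  proof (induction rule: rtrancl_on_induct)
    case base
    show ?case using s by (rule reachable_refl)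
  next
    case (step v w)
    then show ?case by (blast intro: adj)
  qed
  then have "\<exists>p. apath s p v" if "v \<in> verts G" for v
    using that by (simp add: reachable_apath)
  moreover have "p = q" if "apath s p v" "apath s q v" for p q v
    using awalk_unique[OF inj root] that by (blast intro: awalkI_apath)
  ultimately have "\<forall>v\<in>verts G. \<exists>!p. apath s p v"
    by blast
  then show ?thesis
    using s conn no_underlying_cycle[OF inj rank]
    by (auto simp: arborescence_def underlying_tree_def)
qed

lemma (in wf_digraph) spanning_arcs_update:
  assumes "S \<subseteq> arcs G"
  shows "spanning (G\<lparr>arcs := S\<rparr>) G"
  using assms by (auto simp: spanning_def subgraph_def compatible_def wf_digraph_def)

text \<open>Injective heads and an increasing rank pass to subgraphs, so each component inherits
  what makes it an arborescence.\<close>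

lemma (in wf_digraph) branching_arcs_update:
  fixes r :: "'a \<Rightarrow> nat"
  assumes S: "S \<subseteq> arcs G" and inj: "inj_on (head G) S"
    and rank: "\<And>e. e \<in> S \<Longrightarrow> r (tail G e) < r (head G e)"
  shows "branching (G\<lparr>arcs := S\<rparr>) G"
  unfolding branching_def
proof (intro conjI allI impI)
  fix C assume "pre_digraph.max_subgraph (G\<lparr>arcs := S\<rparr>) connected C"
  then have "subgraph C (G\<lparr>arcs := S\<rparr>)" and conn: "connected C"
    by (auto simp: pre_digraph.max_subgraph_def)
  then have C: "wf_digraph C" "arcs C \<subseteq> S" "tail C = tail G" "head C = head G"
    by (auto simp: subgraph_def compatible_def)
  show "\<exists>s. arborescence C s"
  proof (rule wf_digraph.connected_imp_arborescence[OF C(1) conn])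
    show "inj_on (head C) (arcs C)"
      using inj_on_subset[OF inj C(2)] C by simp
    show "r (tail C e) < r (head C e)" if "e \<in> arcs C" for e
      using rank[of e] C that by auto
  qed
qed (rule spanning_arcs_update[OF S])

text \<open>The subgraph induced by \<open>X\<close> competes in the maximum.\<close>

lemma (in fin_digraph) card_induced_arcs_le_fractional_arboricity:
  assumes X: "X \<subseteq> verts G" "1 < card X"
  shows "real (card {e \<in> arcs G. tail G e \<in> X \<and> head G e \<in> X})
           \<le> fractional_arboricity G * (real (card X) - 1)"
proof -
  let ?ratio = "\<lambda>H :: ('a, 'b) pre_digraph. real (card (arcs H)) / (real (card (verts H)) - 1)"
  let ?S = "{?ratio H | H. subgraph H G \<and> 1 < card (verts H)}"
  let ?H = "G \<restriction> X"
  have "?S \<subseteq> (\<lambda>(V, A). real (card A) / (real (card V) - 1)) ` (Pow (verts G) \<times> Pow (arcs G))"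
  proof
    fix x assume "x \<in> ?S"
    then obtain H where "x = ?ratio H" "subgraph H G"
      by blast
    then show "x \<in> (\<lambda>(V, A). real (card A) / (real (card V) - 1)) ` (Pow (verts G) \<times> Pow (arcs G))"
      by (intro image_eqI[of _ _ "(verts H, arcs H)"]) (auto simp: subgraph_def)
  qed
  then have fin: "finite ?S"
    by (rule finite_subset) simp
  have "subgraph ?H G"
    using X by (intro induced_imp_subgraph induced_induce) auto
  then have "?ratio ?H \<in> ?S"
    using X by (intro CollectI exI[of _ ?H]) simp
  then have "?ratio ?H \<le> Max ?S"
    using fin by (rule Max_ge[rotated])
  \<comment> \<open>This rules out the case in which the fractional arboricity has the default value
    0.\<close>
  moreover have "card X \<le> card (verts G)"
    using X by (intro card_mono) auto
  ultimately have "?ratio ?H \<le> fractional_arboricity G"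
    using X by (simp add: fractional_arboricity_def)
  then show ?thesis
    using X by (simp add: field_simps induce_subgraph_def)
qed

section \<open>Splitting off a branching with bounded out-degrees\<close>

theorem theorem2p4:
  fixes D :: "('a, 'b) pre_digraph" and k d :: nat
  assumes "k \<ge> 1" and "d \<ge> 1" and "d \<le> k"
    and "fin_digraph D" and "loopfree_digraph D"
    and "fractional_arboricity D \<le> real k + (real d - real k) / (real d + 1)"
    and "max_in_degree D \<le> k + 1"
  shows "\<exists>B :: nat \<Rightarrow> ('a, 'b) pre_digraph.
           decomposition D {1..k+1} B \<and>
           (\<forall>i \<in> {1..k+1}. branching (B i) D) \<and>
           max_out_degree (B (k + 1)) \<le> d"
proof -
  interpret D: fin_digraph D by fact
  interpret D: loopfree_digraph D by fact
  let ?V = "verts D" and ?t = "tail D" and ?h = "head D"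
  define inner where "inner X = {a \<in> arcs D. ?t a \<in> X \<and> ?h a \<in> X}" for X
  define U where "U = {v \<in> ?V. in_degree D v = k + 1}"
  define N where "N v = ?t ` in_arcs D v" for v
  have fin_inner: "finite (inner X)" for X
    by (simp add: inner_def)
  have finU: "finite U" and UV: "U \<subseteq> ?V"
    by (auto simp: U_def)
  have NV: "N v \<subseteq> ?V" and finN: "finite (N v)" for v
    by (auto simp: N_def in_arcs_def)
  have indeg: "in_degree D v \<le> k + 1" if "v \<in> ?V" for v
  proof -
    have "in_degree D v \<le> Max (in_degree D ` ?V)"
      using that by (intro Max_ge) auto
    then show ?thesis
      using that assms(7) by (auto simp: max_in_degree_def split: if_splits)
  qed
  have gamma_eq: "real k + (real d - real k) / (real d + 1) = real d * (real k + 1) / (real d + 1)"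
    by (simp add: field_simps)
  have inner_le: "(d + 1) * card (inner X) \<le> d * (k + 1) * (card X - 1)"
    if X: "X \<subseteq> ?V" "1 < card X" for X
  proof -
    have "real (card (inner X)) \<le> fractional_arboricity D * (real (card X) - 1)"
      using D.card_induced_arcs_le_fractional_arboricity[OF X] by (simp add: inner_def)
    also have "\<dots> \<le> real d * (real k + 1) / (real d + 1) * (real (card X) - 1)"
      using X assms(6) unfolding gamma_eq by (intro mult_right_mono) auto
    finally have "real (d + 1) * real (card (inner X)) \<le> real (d * (k + 1)) * (real (card X) - 1)"
      by (simp add: field_simps)
    also have "real (card X) - 1 = real (card X - 1)"
      using X by simp
    finally show ?thesis
      by (metis of_nat_le_iff of_nat_mult)
  qed
  have sparse: "card (inner X) \<le> k * (card X - 1)" if X: "X \<subseteq> ?V" "X \<noteq> {}" for X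
  proof (cases "1 < card X")
    case True
    have "(d + 1) * card (inner X) \<le> d * (k + 1) * (card X - 1)"
      using X True by (intro inner_le)
    also have "\<dots> \<le> (d + 1) * k * (card X - 1)"
      using assms(3) by (intro mult_right_mono) (simp_all add: algebra_simps)
    finally have "(d + 1) * card (inner X) \<le> (d + 1) * (k * (card X - 1))"
      by (simp only: mult.assoc)
    then show ?thesis
      by (simp only: mult_le_cancel1)
  next
    case False
    then obtain x where "X = {x}"
      using X by (metis D.finite_verts One_nat_def card_0_eq card_1_singletonE finite_subset
        less_one linorder_neqE_nat)
    then have "inner X = {}"
      by (auto simp: inner_def dest: D.no_loops)
    then show ?thesis by simp
  qed
  have hall: "card X \<le> sum (\<lambda>_. d) (\<Union> (N ` X) - X)" if X: "X \<subseteq> U" for X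
  proof (cases "X = {}")
    case False
    define W where "W = X \<union> \<Union> (N ` X)"
    have finX: "finite X" using X finU by (rule finite_subset)
    have W: "W \<subseteq> ?V" "finite W" using X UV NV finX finN by (auto simp: W_def)
    have "(k + 1) * card X = (\<Sum>v\<in>X. card (in_arcs D v))"
      using X by (simp add: U_def in_degree_def subset_iff)
    also have "\<dots> = card (\<Union>v\<in>X. in_arcs D v)"
      using finX by (intro card_UN_disjoint[symmetric]) (auto simp: in_arcs_def)
    also have "\<dots> \<le> card (inner W)"
      by (intro card_mono fin_inner) (auto simp: inner_def W_def N_def in_arcs_def)
    finally have le: "(k + 1) * card X \<le> card (inner W)" .
    have "card X > 0" using False finX by (simp add: card_gt_0_iff)
    \<comment> \<open>A single vertex has no inner arcs by \<open>sparse\<close>, whereas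
      \<open>inner W\<close> contains all arcs entering \<open>X\<close>.\<close>
    have "1 < card W"
    proof -
      have "card (inner W) > 0" using le \<open>card X > 0\<close> by (simp add: Suc_le_eq)
      moreover have "W \<noteq> {}" using False by (simp add: W_def)
      ultimately have "0 < k * (card W - 1)"
        using sparse[OF W(1)] by linarith
      then show ?thesis by simp
    qed
    \<comment> \<open>Comparing the lower and upper bounds on \<open>card (inner W)\<close> and
      cancelling \<open>k + 1\<close>, then \<open>d * card X\<close>, leaves Hall's condition with
      capacity \<open>d\<close>.\<close>
    have "(k + 1) * ((d + 1) * card X) = (d + 1) * ((k + 1) * card X)"
      by (simp only: ac_simps)
    also have "\<dots> \<le> (d + 1) * card (inner W)"
      using le by (rule mult_le_mono2)
    also have "\<dots> \<le> (k + 1) * (d * (card W - 1))"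
      using inner_le[OF W(1) \<open>1 < card W\<close>] by (simp only: ac_simps)
    finally have "(d + 1) * card X \<le> d * (card W - 1)"
      by (simp only: mult_le_cancel1)
    also have "\<dots> \<le> d * card W"
      by simp
    also have "card W = card X + card (\<Union> (N ` X) - X)"
      using finX finN unfolding W_def by (subst card_Un_disjoint[symmetric]) (auto simp: Un_Diff_cancel)
    finally show ?thesis by (simp add: algebra_simps)
  qed simp
  obtain p and r :: "'a \<Rightarrow> nat" where
    p: "\<forall>v\<in>U. p v \<in> N v \<and> r (p v) < r v" "\<forall>x. card {v \<in> U. p v = x} \<le> d"
    using acyclic_assignment[OF finU finN hall] by blast
  have "\<exists>a. a \<in> in_arcs D v \<and> ?t a = p v" if "v \<in> U" for v
  proof -
    have "p v \<in> ?t ` in_arcs D v" using p(1) that by (simp add: N_def)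
    then show ?thesis by (metis imageE)
  qed
  \<comment> \<open>\<open>p\<close> chooses tails only; \<open>m\<close> picks one of the possibly
    parallel arcs from \<open>p v\<close> to \<open>v\<close>.\<close>
  then obtain m where m: "\<forall>v\<in>U. m v \<in> in_arcs D v \<and> ?t (m v) = p v"
    by metis
  define M where "M = m ` U"
  have M: "M \<subseteq> arcs D" "inj_on ?h M" "\<And>e. e \<in> M \<Longrightarrow> r (?t e) < r (?h e)"
    using m p(1) by (auto simp: M_def in_arcs_def inj_on_def)
  have M_out: "card {a \<in> M. ?t a = x} \<le> d" for x
  proof -
    have "{a \<in> M. ?t a = x} = m ` {v \<in> U. p v = x}"
      using m by (auto simp: M_def)
    then show ?thesis
      using card_image_le[of "{v \<in> U. p v = x}" m] p(2)[rule_format, of x] finU by simp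
  qed
  \<comment> \<open>Deleting \<open>M\<close> removes an entering arc at each vertex of in-degree
    \<open>k + 1\<close>, so all in-degrees become at most \<open>k\<close>.\<close>
  define A where "A = arcs D - M"
  have "\<exists>F :: nat \<Rightarrow> 'b set. (\<Union>i<k. F i) = A \<and> disjoint_family_on F {..<k} \<and>
      (\<forall>i<k. inj_on ?h (F i) \<and> (\<exists>r :: 'a \<Rightarrow> nat. \<forall>a\<in>F i. r (?t a) < r (?h a)))"
  proof (rule frank_branching_decomposition)
    show "card {a \<in> A. ?h a = v} \<le> k" if v: "v \<in> ?V" for v
    proof (cases "v \<in> U")
      case True
      then have "{a \<in> A. ?h a = v} \<subset> in_arcs D v"
        using m by (auto simp: A_def M_def in_arcs_def)
      then have "card {a \<in> A. ?h a = v} < in_degree D v"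
        unfolding in_degree_def by (intro psubset_card_mono) auto
      then show ?thesis using True by (simp add: U_def)
    next
      case False
      have "card {a \<in> A. ?h a = v} \<le> in_degree D v"
        unfolding in_degree_def by (intro card_mono) (auto simp: A_def in_arcs_def)
      then show ?thesis
        using False v indeg[OF v] by (simp add: U_def)
    qed
    show "card {a \<in> A. ?t a \<in> X \<and> ?h a \<in> X} \<le> k * (card X - 1)" if X: "X \<subseteq> ?V" "X \<noteq> {}" for X
    proof -
      have "card {a \<in> A. ?t a \<in> X \<and> ?h a \<in> X} \<le> card (inner X)"
        by (intro card_mono fin_inner) (auto simp: inner_def A_def)
      then show ?thesis using sparse[OF X] by (rule order_trans)
    qed
  qed (auto simp: A_def)
  then obtain F :: "nat \<Rightarrow> 'b set" where F: "(\<Union>i<k. F i) = A" "disjoint_family_on F {..<k}"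
      "\<And>i. i < k \<Longrightarrow> inj_on ?h (F i)"
      "\<And>i. i < k \<Longrightarrow> \<exists>r :: 'a \<Rightarrow> nat. \<forall>a\<in>F i. r (?t a) < r (?h a)"
    by blast
  \<comment> \<open>Indices 1 to \<open>k\<close> carry the sets \<open>F 0\<close> to
    \<open>F (k - 1)\<close>, and index \<open>k + 1\<close> carries \<open>M\<close>.\<close>
  define S where "S i = (if i = k + 1 then M else F (i - 1))" for i
  define B where "B i = D\<lparr>arcs := S i\<rparr>" for i
  have SA: "S i \<subseteq> A" if "i \<in> {1..k}" for i
    using that F(1) by (auto simp: S_def)
  have S_arcs: "S i \<subseteq> arcs D" if "i \<in> {1..k + 1}" for i
    using that SA[of i] M(1) by (cases "i = k + 1") (auto simp: S_def A_def)
  have branch: "branching (B i) D" if "i \<in> {1..k + 1}" for i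
  proof (cases "i = k + 1")
    case True
    then show ?thesis
      using M unfolding B_def S_def by (simp add: D.branching_arcs_update[of _ r])
  next
    case False
    then have i: "i - 1 < k" using that by auto
    then obtain r' :: "'a \<Rightarrow> nat" where "\<forall>a\<in>F (i - 1). r' (?t a) < r' (?h a)"
      using F(4) by blast
    then show ?thesis
      unfolding B_def using False i F(3) S_arcs[OF that]
      by (intro D.branching_arcs_update[of _ r']) (auto simp: S_def)
  qed
  have disj: "S i \<inter> S j = {}" if ij: "i \<in> {1..k + 1}" "j \<in> {1..k + 1}" "i \<noteq> j" for i j
  proof -
    consider "i = k + 1" "j \<in> {1..k}" | "j = k + 1" "i \<in> {1..k}" | "i \<in> {1..k}" "j \<in> {1..k}"
      using ij unfolding atLeastAtMost_iff by linarith
    then show ?thesis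
    proof cases
      case 1
      then show ?thesis using SA[of j] by (auto simp: S_def A_def)
    next
      case 2
      then show ?thesis using SA[of i] by (auto simp: S_def A_def)
    next
      case 3
      then have "i - 1 < k" "j - 1 < k" "i - 1 \<noteq> j - 1" using ij by auto
      then have "F (i - 1) \<inter> F (j - 1) = {}"
        using F(2) by (auto simp: disjoint_family_on_def)
      then show ?thesis using 3 by (simp add: S_def)
    qed
  qed
  have "(\<Union>i\<in>{1..k + 1}. S i) = arcs D"
  proof
    show "(\<Union>i\<in>{1..k + 1}. S i) \<subseteq> arcs D"
      using S_arcs by blast
    show "arcs D \<subseteq> (\<Union>i\<in>{1..k + 1}. S i)"
    proof
      fix a assume "a \<in> arcs D"
      then consider "a \<in> M" | i where "i < k" "a \<in> F i"
        using F(1) by (auto simp: A_def)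
      then show "a \<in> (\<Union>i\<in>{1..k + 1}. S i)"
      proof cases
        case 1
        then have "a \<in> S (k + 1)" by (simp add: S_def)
        then show ?thesis by force
      next
        case 2
        then have "a \<in> S (Suc i)" "Suc i \<in> {1..k + 1}" by (auto simp: S_def)
        then show ?thesis by blast
      qed
    qed
  qed
  then have "D.Union (B ` {1..k + 1}) = D"
    by (auto simp: D.Union_def B_def)
  then have "decomposition D {1..k + 1} B"
    unfolding decomposition_def
    using disj branch by (auto simp: branching_def spanning_def B_def)
  moreover have "max_out_degree (B (k + 1)) \<le> d"
    using M_out by (auto simp: max_out_degree_def B_def S_def out_degree_def out_arcs_def)
  ultimately show ?thesis
    using branch by blast
qed

end
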